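(* Let $\lambda$ be a partition. Then $c^\lambda_{sp}(u)\notin\{1,-1\}$ for all cells $u\in\lambda$ if and only if $\lambda=\emptyset$ or $\lambda=\delta_r=(r,r-1,\dots,2,1)$ for some positive integer $r$.
   Context: For a partition $\lambda$ with conjugate $\lambda'$ (cells $(i,j)$ = row $i$, column $j$ of the Young diagram; $\lambda_i=0$ beyond the length), the symplectic content of a cell $(i,j)\in\lambda$ is $c^\lambda_{sp}(i,j)=\lambda_i+\lambda_j-i-j+2$ if $i>j$, and $c^\lambda_{sp}(i,j)=i+j-\lambda'_i-\lambda'_j$ if $i\le j$. The staircase partition $\delta_r$ is $(r,r-1,\dots,2,1)$. *)

theory Defs
  imports Main
begin

text \<open>Partitions are the finite lists of their positive parts; the empty partition is \<open>[]\<close>.\<close>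

definition is_partition :: "nat list \<Rightarrow> bool" where
  "is_partition l \<longleftrightarrow> sorted_wrt (\<ge>) l \<and> (\<forall>x \<in> set l. 0 < x)"

text \<open>Parts, rows and columns are numbered from 1. The value of \<open>part\<close> at index 0 is irrelevant.\<close>

definition part :: "nat list \<Rightarrow> nat \<Rightarrow> nat" where
  "part l i = (if 1 \<le> i \<and> i \<le> length l then l ! (i - 1) else 0)"

definition cells :: "nat list \<Rightarrow> (nat \<times> nat) set" where
  "cells l = {(i, j). 1 \<le> i \<and> i \<le> length l \<and> 1 \<le> j \<and> j \<le> part l i}"

definition conjugate :: "nat list \<Rightarrow> nat list" where
  "conjugate l = map (\<lambda>j. card {i. (i, j) \<in> cells l}) [1..<Suc (part l 1)]"

definition sp_content :: "nat list \<Rightarrow> nat \<times> nat \<Rightarrow> int" where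
  "sp_content l = (\<lambda>(i, j).
     if i > j
     then int (part l i) + int (part l j) - int i - int j + 2
     else int i + int j - int (part (conjugate l) i) - int (part (conjugate l) j))"

definition staircase :: "nat \<Rightarrow> nat list" where
  "staircase r = rev [1..<Suc r]"

lemma part_antimono:
  assumes "is_partition l" "1 \<le> i" "i \<le> k"
  shows "part l k \<le> part l i"
proof (cases "i = k")
  case False
  then show ?thesis
    using assms by (auto simp: is_partition_def part_def sorted_wrt_iff_nth_less)
qed simp

lemma part_conjugate:
  assumes "is_partition l" "1 \<le> j"
  shows "part (conjugate l) j = card {i. (i, j) \<in> cells l}"
proof -
  have len: "length (conjugate l) = part l 1"
    by (simp add: conjugate_def del: upt_Suc)
  show ?thesis
  proof (cases "j \<le> part l 1")
    case True
    have "[1..<Suc (part l 1)] ! (j - 1) = j"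
      using True assms(2) by (subst nth_upt) auto
    then have "conjugate l ! (j - 1) = card {i. (i, j) \<in> cells l}"
      using True assms(2) by (simp add: conjugate_def del: upt_Suc)
    then show ?thesis
      using True assms(2) by (simp add: part_def[of "conjugate l" j] len)
  next
    case False
    then have "{i. (i, j) \<in> cells l} = {}"
      using part_antimono[OF assms(1), of 1] by (force simp: cells_def)
    then show ?thesis
      using False by (simp add: part_def[of "conjugate l" j] len)
  qed
qed

lemma cells_conjugate:
  assumes "is_partition l"
  shows "(j, i) \<in> cells (conjugate l) \<longleftrightarrow> (i, j) \<in> cells l"
proof -
  have len: "1 \<le> k \<and> k \<le> length m \<and> 1 \<le> n \<and> n \<le> part m k \<longleftrightarrow> 1 \<le> k \<and> 1 \<le> n \<and> n \<le> part m k"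
    for k n m by (auto simp: part_def)
  have in_cells: "(k, n) \<in> cells m \<longleftrightarrow> 1 \<le> k \<and> 1 \<le> n \<and> n \<le> part m k" for k n m
    using len by (simp add: cells_def)
  have fin: "finite {k. (k, n) \<in> cells l}" for n
    by (rule finite_subset[of _ "{..length l}"]) (auto simp: cells_def)
  show ?thesis
  proof (cases "1 \<le> i \<and> 1 \<le> j")
    case True
    let ?K = "{k. (k, j) \<in> cells l}"
    have "i \<le> card ?K \<longleftrightarrow> i \<in> ?K"
    proof
      assume "i \<in> ?K"
      then have "{1..i} \<subseteq> ?K"
        using part_antimono[OF assms] by (force simp: in_cells)
      from card_mono[OF fin this] show "i \<le> card ?K" by simp
    next
      assume i: "i \<le> card ?K"
      show "i \<in> ?K"
      proof (rule ccontr)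
        assume ni: "i \<notin> ?K"
        have "?K \<subseteq> {1..<i}"
        proof
          fix k assume k: "k \<in> ?K"
          have "\<not> i \<le> k"
            using k ni True part_antimono[OF assms, of i k] by (auto simp: in_cells)
          with k show "k \<in> {1..<i}" by (simp add: in_cells)
        qed
        from card_mono[OF _ this] have "card ?K \<le> i - 1" by simp
        with i True show False by linarith
      qed
    qed
    with True show ?thesis
      by (simp add: in_cells[of j i] part_conjugate[OF assms])
  qed (auto simp: in_cells)
qed

end

theory Submission
  imports Defs
begin

text \<open>
  A cell off the first row and column keeps its symplectic content when the first row and column
  are deleted, so by induction the remaining partition is \<open>\<delta>\<^sub>r\<close> for some \<open>r \<ge> 0\<close>.
  Let \<open>a\<close> and \<open>m\<close> be the lengths of the first row and the first column. If \<open>m < a\<close> or \<open>a < m\<close>,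
  then the cell \<open>(1, m + 1)\<close>, respectively \<open>(a + 1, 1)\<close>, has content 1. If \<open>a = m \<ge> r + 3\<close>, then
  \<open>(1, m - 1)\<close> has content -1, and if \<open>a = m = r + 1\<close> with \<open>r > 0\<close>, then \<open>(1, r + 1)\<close> has
  content -1. What is left are \<open>\<delta>\<^sub>1\<close> and \<open>\<delta>\<^bsub>r+2\<^esub>\<close>. Conversely, all contents of a staircase
  are even.
\<close>

text \<open>Part functions replace lists so that deleting the first row and column is an index shift
  followed by a truncated subtraction of 1.\<close>

definition conjugate_pair :: "(nat \<Rightarrow> nat) \<Rightarrow> (nat \<Rightarrow> nat) \<Rightarrow> bool" where
  "conjugate_pair f g \<longleftrightarrow> (\<forall>i\<ge>1. \<forall>j\<ge>1. j \<le> f i \<longleftrightarrow> i \<le> g j)"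

definition avoids_unit_content :: "(nat \<Rightarrow> nat) \<Rightarrow> (nat \<Rightarrow> nat) \<Rightarrow> bool" where
  "avoids_unit_content f g \<longleftrightarrow>
     (\<forall>i j. 1 \<le> j \<and> j < i \<and> j \<le> f i \<longrightarrow>
        int (f i) + int (f j) - int i - int j + 2 \<notin> {1, -1}) \<and>
     (\<forall>i j. 1 \<le> i \<and> i \<le> j \<and> j \<le> f i \<longrightarrow>
        int i + int j - int (g i) - int (g j) \<notin> {1, -1})"

lemma conjugate_pairD:
  "conjugate_pair f g \<Longrightarrow> 1 \<le> i \<Longrightarrow> 1 \<le> j \<Longrightarrow> j \<le> f i \<longleftrightarrow> i \<le> g j"
  by (auto simp: conjugate_pair_def)

lemma avoids_unit_contentD_below:
  assumes "avoids_unit_content f g" "1 \<le> j" "j < i" "j \<le> f i"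
  shows "int (f i) + int (f j) - int i - int j + 2 \<noteq> 1"
    "int (f i) + int (f j) - int i - int j + 2 \<noteq> -1"
  using assms unfolding avoids_unit_content_def by blast+

lemma avoids_unit_contentD_above:
  assumes "avoids_unit_content f g" "1 \<le> i" "i \<le> j" "j \<le> f i"
  shows "int i + int j - int (g i) - int (g j) \<noteq> 1"
    "int i + int j - int (g i) - int (g j) \<noteq> -1"
  using assms unfolding avoids_unit_content_def by blast+

section \<open>Deleting the first row and column\<close>

lemma conjugate_pair_remove_hook:
  assumes "conjugate_pair f g"
  shows "conjugate_pair (\<lambda>i. f (Suc i) - 1) (\<lambda>j. g (Suc j) - 1)"
  unfolding conjugate_pair_def
proof (intro allI impI)
  fix i j :: nat
  assume "1 \<le> i" "1 \<le> j"
  then show "j \<le> f (Suc i) - 1 \<longleftrightarrow> i \<le> g (Suc j) - 1"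
    using conjugate_pairD[OF assms, of "Suc i" "Suc j"] by auto
qed

text \<open>Moving from (i, j) to (i+1, j+1) raises the index sum by 2, and restoring the hook
  raises the sum of the two parts by 2, so these cancel in the content. The parts involved are
  positive, so the subtraction does not truncate.\<close>

lemma avoids_unit_content_remove_hook:
  assumes fg: "conjugate_pair f g" and av: "avoids_unit_content f g"
  shows "avoids_unit_content (\<lambda>i. f (Suc i) - 1) (\<lambda>j. g (Suc j) - 1)"
  unfolding avoids_unit_content_def
proof (intro conjI allI impI)
  fix i j :: nat
  assume ij: "1 \<le> j \<and> j < i \<and> j \<le> f (Suc i) - 1"
  then have "1 \<le> f (Suc j)"
    using conjugate_pairD[OF fg, of "Suc i" 1] conjugate_pairD[OF fg, of "Suc j" 1] by auto
  moreover have "Suc j \<le> f (Suc i)"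
    using ij by linarith
  ultimately show "int (f (Suc i) - 1) + int (f (Suc j) - 1) - int i - int j + 2 \<notin> {1, -1}"
    using ij avoids_unit_contentD_below[OF av, of "Suc j" "Suc i"] by (auto simp: of_nat_diff)
next
  fix i j :: nat
  assume ij: "1 \<le> i \<and> i \<le> j \<and> j \<le> f (Suc i) - 1"
  then have "Suc j \<le> f (Suc i)"
    by linarith
  moreover from this have "Suc i \<le> g (Suc j)"
    using conjugate_pairD[OF fg, of "Suc i" "Suc j"] by auto
  \<comment> \<open>Since i \<le> j, the diagonal cell (i+1, i+1) lies in the diagram.\<close>
  moreover have "1 \<le> g (Suc i)"
    using ij conjugate_pairD[OF fg, of "Suc i" "Suc i"] by auto
  ultimately show "int i + int j - int (g (Suc i) - 1) - int (g (Suc j) - 1) \<notin> {1, -1}"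
    using ij avoids_unit_contentD_above[OF av, of "Suc i" "Suc j"] by (auto simp: of_nat_diff)
qed

text \<open>For i > r, \<open>inner_f\<close> cannot tell \<open>f (Suc i) = 0\<close> from
  \<open>f (Suc i) = 1\<close>, and likewise for \<open>g\<close>. Only the lengths
  \<open>f 1\<close> and \<open>g 1\<close> remain free, and single cells of the first row or column
  restrict them.\<close>

lemma staircase_extension:
  assumes fg: "conjugate_pair f g" and av: "avoids_unit_content f g" and pos: "0 < f 1"
    and inner_f: "\<And>i. 1 \<le> i \<Longrightarrow> f (Suc i) - 1 = Suc r - i"
    and inner_g: "\<And>j. 1 \<le> j \<Longrightarrow> g (Suc j) - 1 = Suc r - j"
  shows "\<exists>s. \<forall>i\<ge>1. f i = Suc s - i"
proof -
  have g1: "0 < g 1"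
    using conjugate_pairD[OF fg, of 1 1] pos by auto
  have f_pos: "1 \<le> f i \<longleftrightarrow> i \<le> g 1" if "1 \<le> i" for i
    using conjugate_pairD[OF fg, of i 1] that by auto
  have g_pos: "j \<le> f 1 \<longleftrightarrow> 1 \<le> g j" if "1 \<le> j" for j
    using conjugate_pairD[OF fg, of 1 j] that by auto
  \<comment> \<open>For r > 0, column r+1 has height 2, so row 1 reaches it.\<close>
  have f_ge: "Suc r \<le> f 1"
    using g_pos[of "Suc r"] inner_g[of r] pos by (cases "r = 0") auto
  have g_ge: "Suc r \<le> g 1"
    using f_pos[of "Suc r"] inner_f[of r] g1 by (cases "r = 0") auto
  have f_one: "f (Suc i) = 1" if "r < i" "Suc i \<le> g 1" for i
    using f_pos[of "Suc i"] inner_f[of i] that by auto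
  have g_one: "g (Suc j) = 1" if "r < j" "Suc j \<le> f 1" for j
    using g_pos[of "Suc j"] inner_g[of j] that by auto
  \<comment> \<open>Column \<open>g 1 + 1\<close> would have height 1, giving its top cell content 1
    + (\<open>g 1\<close> + 1) - \<open>g 1\<close> - 1 = 1.\<close>
  have "\<not> g 1 < f 1"
    using g_one[of "g 1"] g_ge avoids_unit_contentD_above[OF av, of 1 "Suc (g 1)"] by auto
  moreover have "\<not> f 1 < g 1"
    using f_one[of "f 1"] f_ge pos avoids_unit_contentD_below[OF av, of 1 "Suc (f 1)"] by auto
  ultimately have eq: "f 1 = g 1" by simp
  have le: "g 1 \<le> r + 2"
  proof (rule ccontr)
    assume "\<not> g 1 \<le> r + 2"
    \<comment> \<open>Column k+1 has height 1, so the cell (1, k+1) has content 1 + (k+1) - (k+2) -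
      1 = -1.\<close>
    then obtain k where k: "g 1 = Suc (Suc k)" "r < k"
      by (metis add_2_eq_Suc' less_imp_Suc_add not_le Suc_less_eq2 Suc_less_eq)
    then show False
      using g_one[of k] eq avoids_unit_contentD_above[OF av, of 1 "Suc k"] by auto
  qed
  consider "r = 0" "g 1 = 1" | "r > 0" "g 1 = Suc r" | "g 1 = r + 2"
    using le g_ge by linarith
  then show ?thesis
  proof cases
    case 1
    have "f i = Suc 1 - i" if "1 \<le> i" for i
      using f_pos[of i] 1 eq that by (cases "i = 1") auto
    then show ?thesis by blast
  next
    case 2
    then have "g (Suc r) = 2"
      using inner_g[of r] by auto
    then show ?thesis
      using 2 eq avoids_unit_contentD_above[OF av, of 1 "Suc r"] by auto
  next
    case 3
    have "f i = Suc (r + 2) - i" if "1 \<le> i" for i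
    proof (cases i)
      case (Suc k)
      show ?thesis
      proof (cases "k = 0")
        case False
        then show ?thesis
          using inner_f[of k] f_pos[of i] 3 Suc by auto
      qed (use 3 eq Suc in simp)
    qed (use that in simp)
    then show ?thesis by blast
  qed
qed

text \<open>Staircases are self-conjugate: for positive i and j, both j \<le> r+1-i and i \<le>
  r+1-j mean i+j \<le> r+1.\<close>

lemma conjugate_pair_staircase:
  assumes fg: "conjugate_pair f g" and f: "\<And>i. 1 \<le> i \<Longrightarrow> f i = Suc r - i" and j: "1 \<le> j"
  shows "g j = Suc r - j"
proof -
  have "i \<le> g j \<longleftrightarrow> i \<le> Suc r - j" if "1 \<le> i" for i
    using conjugate_pairD[OF fg that j] f[OF that] that j by auto
  from this[of "g j"] this[of "Suc r - j"] show ?thesis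
    by (cases "g j = 0"; cases "Suc r - j = 0") auto
qed

lemma avoids_unit_content_imp_staircase:
  assumes "conjugate_pair f g" "avoids_unit_content f g"
  shows "\<exists>r. \<forall>i\<ge>1. f i = Suc r - i"
  using assms
proof (induction "f 1" arbitrary: f g rule: less_induct)
  case less
  show ?case
  proof (cases "f 1 = 0")
    case True
    have "f i = Suc 0 - i" if "1 \<le> i" for i
      using conjugate_pairD[OF less.prems(1), of i 1] conjugate_pairD[OF less.prems(1), of 1 1]
        True that by auto
    then show ?thesis by blast
  next
    case False
    \<comment> \<open>If row 2 is nonempty, its last column has height at least 2 and so also meets
      row 1. Hence the first row strictly shrinks in the induction.\<close>
    have "f (Suc 1) \<le> f 1"
      using conjugate_pairD[OF less.prems(1), of "Suc 1" "f (Suc 1)"]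
        conjugate_pairD[OF less.prems(1), of 1 "f (Suc 1)"]
      by (cases "f (Suc 1) = 0") auto
    then have "f (Suc 1) - 1 < f 1"
      using False by linarith
    note inner = conjugate_pair_remove_hook[OF less.prems(1)]
    obtain r where r: "\<And>i. 1 \<le> i \<Longrightarrow> f (Suc i) - 1 = Suc r - i"
      using less.hyps[OF \<open>f (Suc 1) - 1 < f 1\<close> inner
          avoids_unit_content_remove_hook[OF less.prems]] by blast
    then have "\<And>j. 1 \<le> j \<Longrightarrow> g (Suc j) - 1 = Suc r - j"
      using conjugate_pair_staircase[OF inner] by blast
    with less.prems False r show ?thesis
      by (intro staircase_extension) auto
  qed
qed

lemma even_neq_unit: "even (x :: int) \<Longrightarrow> x \<notin> {1, -1}"
  by auto

text \<open>On cells, the contents are 2(r+2-i-j) below the diagonal and 2(i+j-r-1)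
  elsewhere.\<close>

lemma staircase_avoids_unit_content:
  assumes f: "\<And>i. 1 \<le> i \<Longrightarrow> f i = Suc r - i" and g: "\<And>j. 1 \<le> j \<Longrightarrow> g j = Suc r - j"
  shows "avoids_unit_content f g"
  unfolding avoids_unit_content_def
proof (intro conjI allI impI; rule even_neq_unit)
  fix i j :: nat
  assume "1 \<le> j \<and> j < i \<and> j \<le> f i"
  then show "even (int (f i) + int (f j) - int i - int j + 2)"
    using f[of i] f[of j] by (auto simp: of_nat_diff)
next
  fix i j :: nat
  assume "1 \<le> i \<and> i \<le> j \<and> j \<le> f i"
  then show "even (int i + int j - int (g i) - int (g j))"
    using f[of i] g[of i] g[of j] by (auto simp: of_nat_diff)
qed

section \<open>Transfer to partitions as lists\<close>

lemma mem_cells_iff: "(i, j) \<in> cells l \<longleftrightarrow> 1 \<le> i \<and> 1 \<le> j \<and> j \<le> part l i"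
  by (auto simp: cells_def part_def)

lemma conjugate_pair_part:
  assumes "is_partition l"
  shows "conjugate_pair (part l) (part (conjugate l))"
  using cells_conjugate[OF assms] by (auto simp: conjugate_pair_def mem_cells_iff)

lemma avoids_unit_content_part:
  "(\<forall>u \<in> cells l. sp_content l u \<notin> {1, -1}) \<longleftrightarrow>
    avoids_unit_content (part l) (part (conjugate l))" (is "?A \<longleftrightarrow> ?B")
proof
  assume A: ?A
  then have *: "sp_content l (i, j) \<notin> {1, -1}" if "1 \<le> i" "1 \<le> j" "j \<le> part l i" for i j
    using that mem_cells_iff by blast
  show ?B
    unfolding avoids_unit_content_def
  proof (intro conjI allI impI)
    fix i j :: nat
    assume "1 \<le> j \<and> j < i \<and> j \<le> part l i"
    then show "int (part l i) + int (part l j) - int i - int j + 2 \<notin> {1, -1}"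
      using *[of i j] by (simp add: sp_content_def)
  next
    fix i j :: nat
    assume "1 \<le> i \<and> i \<le> j \<and> j \<le> part l i"
    then show "int i + int j - int (part (conjugate l) i) - int (part (conjugate l) j) \<notin> {1, -1}"
      using *[of i j] by (simp add: sp_content_def)
  qed
next
  assume B: ?B
  show ?A
  proof
    fix u
    assume "u \<in> cells l"
    then obtain i j where u: "u = (i, j)" "1 \<le> i" "1 \<le> j" "j \<le> part l i"
      by (cases u) (auto simp: mem_cells_iff)
    then show "sp_content l u \<notin> {1, -1}"
      using avoids_unit_contentD_below[OF B, of j i] avoids_unit_contentD_above[OF B, of i j]
      by (cases "j < i") (simp_all add: sp_content_def)
  qed
qed

lemma part_staircase: "1 \<le> i \<Longrightarrow> part (staircase r) i = Suc r - i"
  by (auto simp: part_def staircase_def rev_nth simp del: upt_Suc)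

lemma part_pos_iff:
  assumes "is_partition l" "1 \<le> i"
  shows "0 < part l i \<longleftrightarrow> i \<le> length l"
  using assms by (auto simp: part_def is_partition_def)

text \<open>As all listed parts are positive, the length is the last index with a nonzero value of
  \<open>part l\<close>, so the part function determines the list.\<close>

lemma part_eq_staircase_imp:
  assumes l: "is_partition l" and p: "\<And>i. 1 \<le> i \<Longrightarrow> part l i = Suc r - i"
  shows "l = staircase r"
proof (rule nth_equalityI)
  have "i \<le> length l \<longleftrightarrow> i \<le> r" if "1 \<le> i" for i
    using part_pos_iff[OF l that] p[OF that] by auto
  from this[of "length l"] this[of r] have "length l = r"
    by (cases "length l = 0"; cases "r = 0") auto
  then show len: "length l = length (staircase r)"
    by (simp add: staircase_def del: upt_Suc)
  fix k
  assume "k < length l"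
  then show "l ! k = staircase r ! k"
    using p[of "Suc k"] part_staircase[of "Suc k" r] len by (simp add: part_def)
qed

theorem theorem2p13:
  fixes l :: "nat list"
  assumes "is_partition l"
  shows "(\<forall>u \<in> cells l. sp_content l u \<notin> {1, -1}) \<longleftrightarrow>
         (l = [] \<or> (\<exists>r::nat. r > 0 \<and> l = staircase r))"
proof -
  note cp = conjugate_pair_part[OF assms]
  have "avoids_unit_content (part l) (part (conjugate l)) \<longleftrightarrow> (\<exists>r. l = staircase r)"
  proof
    assume "avoids_unit_content (part l) (part (conjugate l))"
    from avoids_unit_content_imp_staircase[OF cp this]
    show "\<exists>r. l = staircase r"
      using part_eq_staircase_imp[OF assms] by blast
  next
    assume "\<exists>r. l = staircase r"
    then obtain r where "\<And>i. 1 \<le> i \<Longrightarrow> part l i = Suc r - i"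
      using part_staircase by blast
    then show "avoids_unit_content (part l) (part (conjugate l))"
      using conjugate_pair_staircase[OF cp] by (intro staircase_avoids_unit_content) blast+
  qed
  \<comment> \<open>The empty partition is the case r = 0.\<close>
  also have "\<dots> \<longleftrightarrow> l = [] \<or> (\<exists>r::nat. r > 0 \<and> l = staircase r)"
  proof -
    have "staircase 0 = []"
      by (simp add: staircase_def)
    then show ?thesis
      by (metis gr0I)
  qed
  finally show ?thesis
    by (simp only: avoids_unit_content_part)
qed

end
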